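(* Fix a state $s$, a threshold $\tau\in(0,1)$ and an integer $K\ge 1$. Let strategies $z$ be proposed from a probability distribution $\pi_L(\cdot\mid s)$ on $\mathcal{Z}$, let $q(s,z)\in[0,1]$ be the success probability of strategy $z$ at $s$, and accept a proposed $z$ iff $\hat q_K(s,z)\ge\tau$, where $\hat q_K(s,z)$ is the empirical mean of $K$ i.i.d. Bernoulli trials with mean $q(s,z)$. Let $A_s$ be the acceptance rate and $\pi_{\mathrm{acc}}(\cdot\mid s)$ the distribution of accepted strategies. For any $\eta>0$, define $\delta=e^{-2K\eta^2}$. Then $$\Pr_{z\sim\pi_{\mathrm{acc}}(\cdot\mid s)}\big(q(s,z)\le\tau-\eta\big)\;\le\;\frac{\delta}{A_s},$$ and consequently $$\mathbb{E}_{z\sim\pi_{\mathrm{acc}}(\cdot\mid s)}[q(s,z)]\;\ge\;(\tau-\eta)\Big(1-\frac{\delta}{A_s}\Big).$$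
   Context: $\mathcal{Z}$ is a discrete set of strategies. For fixed $s$, $\pi_L(\cdot\mid s)$ is the teacher's proposal distribution on $\mathcal{Z}$, and $q(s,z)$ is the probability that an execution of strategy $z$ at state $s$ succeeds. Given $z$, the empirical success is $\hat q_K(s,z)=\frac1K\sum_{i=1}^K X_i$ with $X_1,\dots,X_K$ i.i.d. Bernoulli with mean $q(s,z)$, and $\Pr(\text{accept}\mid s,z)=\Pr(\hat q_K(s,z)\ge\tau\mid s,z)$. The acceptance rate is $A_s=\Pr_{z\sim\pi_L(\cdot\mid s)}(\text{accept})=\sum_{z}\pi_L(z\mid s)\Pr(\text{accept}\mid s,z)$, which is positive (so that the accepted distribution is defined). The accepted-strategy distribution is $$\pi_{\mathrm{acc}}(z\mid s)=\frac{\pi_L(z\mid s)\,\Pr(\text{accept}\mid s,z)}{A_s}.$$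
   Formalization: The bound on the expectation is stated only when η ≤ τ or δ ≤ A_s; otherwise both factors are negative and it can fail (one strategy, K=1, τ=1/2, q=1/1000, η=1: right side about 67, mean 1/1000). The first bound is for all η>0. *)

theory Defs
  imports "HOL-Probability.Probability"
begin

text \<open>
  Strategies form a type \<open>'z\<close>; a probability distribution on the discrete set of
  strategies is a \<open>'z pmf\<close>, whose support is countable even if \<open>'z\<close> is not.
\<close>

definition empirical_success :: "nat \<Rightarrow> (nat \<Rightarrow> bool) \<Rightarrow> real" where
  "empirical_success K X = (1 / real K) * (\<Sum>i=1..K. of_bool (X i))"

text \<open>
  Joint law of the \<open>K\<close> executions of \<open>z\<close> at \<open>s\<close>: the product of \<open>K\<close> copies of
  \<open>bernoulli_pmf (q s z)\<close>, with \<open>False\<close> as the dummy value outside the index set.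
  The library truncates the parameter of \<open>bernoulli_pmf\<close> to the unit interval, so
  this is the intended law only if \<open>0 \<le> q s z \<le> 1\<close>.
\<close>

definition trials_pmf :: "nat \<Rightarrow> ('s \<Rightarrow> 'z \<Rightarrow> real) \<Rightarrow> 's \<Rightarrow> 'z \<Rightarrow> (nat \<Rightarrow> bool) pmf" where
  "trials_pmf K q s z = Pi_pmf {1..K} False (\<lambda>_. bernoulli_pmf (q s z))"

definition accept_prob :: "nat \<Rightarrow> real \<Rightarrow> ('s \<Rightarrow> 'z \<Rightarrow> real) \<Rightarrow> 's \<Rightarrow> 'z \<Rightarrow> real" where
  "accept_prob K \<tau> q s z =
     measure_pmf.prob (trials_pmf K q s z) {X. empirical_success K X \<ge> \<tau>}"

definition acceptance_rate ::
  "nat \<Rightarrow> real \<Rightarrow> ('s \<Rightarrow> 'z pmf) \<Rightarrow> ('s \<Rightarrow> 'z \<Rightarrow> real) \<Rightarrow> 's \<Rightarrow> real" where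
  "acceptance_rate K \<tau> \<pi>L q s = (\<Sum>\<^sub>\<infinity>z. pmf (\<pi>L s) z * accept_prob K \<tau> q s z)"

text \<open>
  Meaningful only for a positive acceptance rate; in that case lemma
  \<open>pmf_accepted_pmf\<close> below identifies its mass function.
\<close>

definition accepted_pmf ::
  "nat \<Rightarrow> real \<Rightarrow> ('s \<Rightarrow> 'z pmf) \<Rightarrow> ('s \<Rightarrow> 'z \<Rightarrow> real) \<Rightarrow> 's \<Rightarrow> 'z pmf" where
  "accepted_pmf K \<tau> \<pi>L q s =
     embed_pmf (\<lambda>z. pmf (\<pi>L s) z * accept_prob K \<tau> q s z / acceptance_rate K \<tau> \<pi>L q s)"

lemma acceptance_rate_summable:
  "(\<lambda>z. pmf (\<pi>L s) z * accept_prob K \<tau> q s z) summable_on UNIV"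
proof -
  have "(\<lambda>z. norm (pmf (\<pi>L s) z)) summable_on UNIV"
    using pmf_abs_summable[of "\<pi>L s" UNIV] abs_summable_equivalent by blast
  then have "pmf (\<pi>L s) summable_on UNIV"
    by simp
  then show ?thesis
    by (rule summable_on_comparison_test) (auto simp: accept_prob_def intro!: mult_left_le)
qed

lemma pmf_accepted_pmf:
  assumes "acceptance_rate K \<tau> \<pi>L q s > 0"
  shows "pmf (accepted_pmf K \<tau> \<pi>L q s) z =
    pmf (\<pi>L s) z * accept_prob K \<tau> q s z / acceptance_rate K \<tau> \<pi>L q s"
proof -
  define g where "g = (\<lambda>z. pmf (\<pi>L s) z * accept_prob K \<tau> q s z)"
  define A where "A = acceptance_rate K \<tau> \<pi>L q s"
  have A: "A > 0" "A = infsum g UNIV"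
    using assms by (auto simp: A_def g_def acceptance_rate_def)
  have g0: "g z \<ge> 0" for z
    by (simp add: g_def accept_prob_def)
  have "(\<lambda>z. norm (g z)) summable_on UNIV"
    using acceptance_rate_summable[of \<pi>L s K \<tau> q] g0 by (simp add: g_def)
  then have summ: "Infinite_Set_Sum.abs_summable_on g UNIV"
    using abs_summable_equivalent by blast
  then have int: "integrable (count_space UNIV) g"
    by (simp add: Infinite_Set_Sum.abs_summable_on_def)
  have "infsetsum g UNIV = A"
    using infsetsum_infsum[of g UNIV] summ A by simp
  then have "(\<integral>x. g x / A \<partial>count_space UNIV) = 1"
    using A(1) by (simp add: infsetsum_def)
  then have "(\<integral>\<^sup>+x. ennreal (g x / A) \<partial>count_space UNIV) = 1"
    using int g0 A(1) by (subst nn_integral_eq_integral) auto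
  then show ?thesis
    unfolding accepted_pmf_def A_def[symmetric] using g0 A(1)
    by (subst pmf_embed_pmf) (auto simp: g_def)
qed

end

theory Submission
  imports Defs
begin

text \<open>
  By Hoeffding's inequality a strategy with \<open>q s z \<le> \<tau> - \<eta>\<close> is accepted with probability at
  most \<open>\<delta>\<close>. The accepted law has density \<open>accept_prob / A\<close> with respect to the proposal law, so
  the low-quality strategies have accepted mass at most \<open>\<delta> / A\<close>. Markov's inequality turns this
  into the bound on the mean when \<open>\<eta> \<le> \<tau>\<close>; otherwise its right-hand side is nonpositive.
\<close>

text \<open>Each coordinate of a product law has its factor as marginal. The range hypotheses rule
  out truncation of the Bernoulli parameter; for \<open>i\<close> outside \<open>{1..K}\<close> the
  coordinate would be constantly \<open>False\<close>.\<close>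

lemma expectation_trials_component:
  assumes "0 \<le> q s z" "q s z \<le> 1" "i \<in> {1..K}"
  shows "measure_pmf.expectation (trials_pmf K q s z) (\<lambda>X. of_bool (X i) :: real) = q s z"
proof -
  have "map_pmf (\<lambda>X. X i) (trials_pmf K q s z) = bernoulli_pmf (q s z)"
    using assms(3) by (simp add: trials_pmf_def Pi_pmf_component)
  moreover have "measure_pmf.expectation (trials_pmf K q s z) (\<lambda>X. of_bool (X i) :: real) =
      measure_pmf.expectation (map_pmf (\<lambda>X. X i) (trials_pmf K q s z)) of_bool"
    by simp
  ultimately show ?thesis
    using assms by simp
qed

lemma accept_prob_Hoeffding:
  fixes q :: "'s \<Rightarrow> 'z \<Rightarrow> real"
  assumes K: "K \<ge> 1" and q: "0 \<le> q s z" "q s z \<le> 1"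
    and \<eta>: "\<eta> \<ge> 0" and low: "q s z \<le> \<tau> - \<eta>"
  shows "accept_prob K \<tau> q s z \<le> exp (- 2 * real K * \<eta>\<^sup>2)"
proof -
  let ?M = "trials_pmf K q s z"
  \<comment> \<open>The summands lie between 0 and 1. The locale's mean is given in the closed form
    \<open>real K * q s z\<close>, so its defining equation becomes a proof obligation.\<close>
  interpret Hoeffding_ineq "measure_pmf ?M" "{1..K}" "\<lambda>i X. of_bool (X i)"
    "\<lambda>_. 0" "\<lambda>_. 1" "real K * q s z"
  proof unfold_locales
    show "prob_space.indep_vars (measure_pmf ?M) (\<lambda>_. borel)
        (\<lambda>i X. of_bool (X i) :: real) {1..K}"
      unfolding trials_pmf_def
      by (intro prob_space.indep_vars_compose2[OF _ indep_vars_Pi_pmf])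
         (auto simp: measure_pmf.prob_space_axioms)
  next
    have "(\<Sum>i=1..K. measure_pmf.expectation ?M (\<lambda>X. of_bool (X i) :: real)) =
        (\<Sum>i=1..K. q s z)"
      by (intro sum.cong refl expectation_trials_component q)
    then show "real K * q s z \<equiv>
        \<Sum>i=1..K. measure_pmf.expectation ?M (\<lambda>X. of_bool (X i) :: real)"
      by (simp add: atomize_eq)
  qed auto
  \<comment> \<open>Acceptance forces the sum to exceed its mean by at least
    \<open>real K * \<eta>\<close>: multiply
    \<open>q s z + \<eta> \<le> \<tau> \<le> empirical_success K X\<close> by
    \<open>K\<close>.\<close>
  have "real K * q s z + real K * \<eta> \<le> (\<Sum>i=1..K. of_bool (X i))"
    if "\<tau> \<le> empirical_success K X" for X
  proof -
    have "real K * (q s z + \<eta>) \<le> real K * empirical_success K X"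
      using low that by (intro mult_left_mono) auto
    then show ?thesis
      using K by (simp add: empirical_success_def distrib_left)
  qed
  then have "accept_prob K \<tau> q s z \<le>
      measure_pmf.prob ?M {X. real K * q s z + real K * \<eta> \<le> (\<Sum>i=1..K. of_bool (X i))}"
    unfolding accept_prob_def by (intro measure_pmf.finite_measure_mono) auto
  \<comment> \<open>All \<open>K\<close> ranges have width 1, so the squared widths in the
    denominator of Hoeffding's exponent sum to \<open>K\<close>.\<close>
  also have "\<dots> \<le> exp (- 2 * (real K * \<eta>)\<^sup>2 / real K)"
    using Hoeffding_ineq_ge[of "real K * \<eta>"] K \<eta> by simp
  also have "\<dots> = exp (- 2 * real K * \<eta>\<^sup>2)"
    using K by (simp add: power2_eq_square)
  finally show ?thesis .
qed

text \<open>On \<open>S\<close> the reweighting factor \<open>accept_prob / A\<close> is at most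
  \<open>\<delta> / A\<close>, and the proposal mass of \<open>S\<close> is at most 1.\<close>

lemma prob_accepted_le:
  fixes q :: "'s \<Rightarrow> 'z \<Rightarrow> real"
  assumes A: "acceptance_rate K \<tau> \<pi>L q s > 0" and \<delta>: "\<delta> \<ge> 0"
    and le: "\<And>z. z \<in> S \<Longrightarrow> accept_prob K \<tau> q s z \<le> \<delta>"
  shows "measure_pmf.prob (accepted_pmf K \<tau> \<pi>L q s) S \<le> \<delta> / acceptance_rate K \<tau> \<pi>L q s"
proof -
  define A where "A = acceptance_rate K \<tau> \<pi>L q s"
  let ?P = "accepted_pmf K \<tau> \<pi>L q s"
  have A0: "A > 0"
    using assms(1) by (simp add: A_def)
  have "emeasure (measure_pmf ?P) S =
      (\<integral>\<^sup>+z. ennreal (pmf ?P z) * indicator S z \<partial>count_space UNIV)"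
    by (simp flip: nn_integral_measure_pmf)
  \<comment> \<open>The bound extends from \<open>S\<close> to all strategies because
    \<open>\<delta> / A\<close> is nonnegative; the right-hand side then integrates to
    \<open>\<delta> / A\<close> times the total proposal mass 1.\<close>
  also have "\<dots> \<le> (\<integral>\<^sup>+z. ennreal (pmf (\<pi>L s) z) * ennreal (\<delta> / A) \<partial>count_space UNIV)"
  proof (intro nn_integral_mono)
    fix z
    have "pmf (\<pi>L s) z * accept_prob K \<tau> q s z / A \<le> pmf (\<pi>L s) z * (\<delta> / A)" if "z \<in> S"
      using le[OF that] A0 by (simp add: divide_right_mono mult_left_mono)
    then show "ennreal (pmf ?P z) * indicator S z \<le> ennreal (pmf (\<pi>L s) z) * ennreal (\<delta> / A)"
      using A0 \<delta>
      by (auto simp: pmf_accepted_pmf[OF A] A_def[symmetric] indicator_def ennreal_leI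
               simp flip: ennreal_mult')
  qed
  also have "\<dots> = ennreal (\<delta> / A)"
    by (simp flip: nn_integral_measure_pmf)
  finally have "emeasure (measure_pmf ?P) S \<le> ennreal (\<delta> / A)" .
  then show ?thesis
    using A0 \<delta> by (simp add: measure_pmf.emeasure_eq_measure A_def)
qed

text \<open>Markov's inequality in complementary form: \<open>c\<close> times the indicator of
  \<open>f x > c\<close> lies pointwise below \<open>f\<close>.\<close>

lemma expectation_ge_mult_prob:
  fixes f :: "'a \<Rightarrow> real"
  assumes "integrable (measure_pmf p) f" "\<And>x. 0 \<le> f x" "0 \<le> c"
  shows "c * (1 - measure_pmf.prob p {x. f x \<le> c}) \<le> measure_pmf.expectation p f"
proof -
  have "c * (1 - measure_pmf.prob p {x. f x \<le> c}) = c * measure_pmf.prob p (- {x. f x \<le> c})"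
    using measure_pmf.prob_compl[of "{x. f x \<le> c}" p] by (simp add: Compl_eq_Diff_UNIV)
  also have "\<dots> = measure_pmf.expectation p (\<lambda>x. c * indicator (- {x. f x \<le> c}) x)"
    by simp
  also have "\<dots> \<le> measure_pmf.expectation p f"
  proof (intro integral_mono)
    show "integrable (measure_pmf p) (\<lambda>x. c * indicator (- {x. f x \<le> c}) x)"
      by (intro integrable_mult_right measure_pmf.integrable_const_bound[where B = 1]) auto
  qed (use assms in \<open>auto simp: indicator_def\<close>)
  finally show ?thesis .
qed

text \<open>The mean bound carries a guard: if \<open>\<eta> > \<tau>\<close> and
  \<open>\<delta>\<close> exceeds the acceptance rate, both factors on its right are negative, and
  their product can exceed 1, as for \<open>K = 1\<close>, \<open>\<tau> = 0.5\<close>,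
  \<open>\<eta> = 0.6\<close> and \<open>q\<close> constantly 0.01.\<close>

theorem theorem4:
  fixes \<pi>L :: "'s \<Rightarrow> 'z pmf" and q :: "'s \<Rightarrow> 'z \<Rightarrow> real" and s :: 's
    and \<tau> \<eta> \<delta> :: real and K :: nat
  assumes "0 < \<tau>" and "\<tau> < 1" and "K \<ge> 1"
    and "\<And>z. 0 \<le> q s z" and "\<And>z. q s z \<le> 1"
    and "acceptance_rate K \<tau> \<pi>L q s > 0"
    and "\<eta> > 0" and "\<delta> = exp (- 2 * real K * \<eta>\<^sup>2)"
  shows "measure_pmf.prob (accepted_pmf K \<tau> \<pi>L q s) {z. q s z \<le> \<tau> - \<eta>}
           \<le> \<delta> / acceptance_rate K \<tau> \<pi>L q s
       \<and> (\<eta> \<le> \<tau> \<or> \<delta> \<le> acceptance_rate K \<tau> \<pi>L q s \<longrightarrow>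
           measure_pmf.expectation (accepted_pmf K \<tau> \<pi>L q s) (\<lambda>z. q s z)
             \<ge> (\<tau> - \<eta>) * (1 - \<delta> / acceptance_rate K \<tau> \<pi>L q s))"
proof -
  define A where "A = acceptance_rate K \<tau> \<pi>L q s"
  let ?P = "accepted_pmf K \<tau> \<pi>L q s"
  have A0: "A > 0" and \<delta>0: "\<delta> \<ge> 0"
    using assms by (simp_all add: A_def)
  have tail: "measure_pmf.prob ?P {z. q s z \<le> \<tau> - \<eta>} \<le> \<delta> / A"
    unfolding A_def
  proof (rule prob_accepted_le)
    show "accept_prob K \<tau> q s z \<le> \<delta>" if "z \<in> {z. q s z \<le> \<tau> - \<eta>}" for z
      unfolding assms(8) using assms that by (intro accept_prob_Hoeffding) auto
  qed (use assms \<delta>0 in auto)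
  have "(\<tau> - \<eta>) * (1 - \<delta> / A) \<le> measure_pmf.expectation ?P (q s)" if "\<eta> \<le> \<tau> \<or> \<delta> \<le> A"
  proof (cases "\<eta> \<le> \<tau>")
    case True
    have "integrable (measure_pmf ?P) (q s)"
      using assms(4,5) by (intro measure_pmf.integrable_const_bound[where B = 1]) auto
    then have "(\<tau> - \<eta>) * (1 - measure_pmf.prob ?P {z. q s z \<le> \<tau> - \<eta>})
        \<le> measure_pmf.expectation ?P (q s)"
      using assms(4) True by (intro expectation_ge_mult_prob) auto
    \<comment> \<open>The tail bound may be inserted because the factor
      \<open>\<tau> - \<eta>\<close> is nonnegative here.\<close>
    moreover have "(\<tau> - \<eta>) * (1 - \<delta> / A) \<le>
        (\<tau> - \<eta>) * (1 - measure_pmf.prob ?P {z. q s z \<le> \<tau> - \<eta>})"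
      using tail True by (intro mult_left_mono) auto
    ultimately show ?thesis by linarith
  next
    case False
    \<comment> \<open>Now the guard leaves \<open>\<delta> \<le> A\<close>, so a negative factor
      meets a nonnegative one.\<close>
    then have "(\<tau> - \<eta>) * (1 - \<delta> / A) \<le> 0"
      using that A0 by (intro mult_nonpos_nonneg) auto
    also have "0 \<le> measure_pmf.expectation ?P (q s)"
      using assms(4) by (intro Bochner_Integration.integral_nonneg) auto
    finally show ?thesis .
  qed
  with tail show ?thesis
    by (simp add: A_def)
qed

end
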